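(* Let $X$ and $Y$ be Banach spaces. (a) $X\oplus_\infty Y$ has the SSD2P if and only if $X$ or $Y$ has the SSD2P. (b) If $N$ is an absolute normalized norm on $\mathbb{R}^2$ different from the $\ell_\infty$-norm, then $X\oplus_N Y$ does not have the SSD2P.
   Context: All Banach spaces are nontrivial (i.e. $\neq\{0\}$) and over the real field. $B_X$ and $S_X$ denote the closed unit ball and unit sphere of $X$, and $X^*$ its dual. A slice of $B_X$ is a set $S(B_X,x^*,\alpha)=\{x\in B_X: x^*(x)>1-\alpha\}$ with $x^*\in S_{X^*}$ and $\alpha>0$. A Banach space $X$ has the symmetric strong diameter 2 property (SSD2P) if for every finite family $\{S_i\}_{i=1}^n$ of slices of $B_X$ and every $\varepsilon>0$ there exist $x_i\in S_i$ and $y\in B_X$, with $y$ independent of $i$, such that $x_i\pm y\in S_i$ for every $i\in\{1,\dots,n\}$ and $\|y\|>1-\varepsilon$. A norm $N$ on $\mathbb{R}^2$ is absolute if $N(a,b)=N(|a|,|b|)$ for all $(a,b)\in\mathbb{R}^2$, and normalized if $N(1,0)=N(0,1)=1$. For an absolute normalized norm $N$, $X\oplus_N Y$ denotes the product space $X\times Y$ with the norm $\|(x,y)\|_N=N(\|x\|,\|y\|)$; $X\oplus_\infty Y$ is the case where $N$ is the $\ell_\infty$-norm $N(a,b)=\max\{|a|,|b|\}$. *)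

theory Defs
  imports "HOL-Analysis.Analysis"
begin

text \<open>
  The norm of a type in class \<open>real_normed_vector\<close> is fixed, and the product type carries
  the Euclidean one. The notions below therefore take the norm as an explicit argument \<open>p\<close>;
  with \<open>p = norm\<close> they refer to the norm of the type class.
\<close>

definition is_norm :: "('v::real_vector \<Rightarrow> real) \<Rightarrow> bool" where
  "is_norm p \<longleftrightarrow>
     (\<forall>x. 0 \<le> p x) \<and> (\<forall>x. p x = 0 \<longleftrightarrow> x = 0) \<and>
     (\<forall>c x. p (c *\<^sub>R x) = \<bar>c\<bar> * p x) \<and> (\<forall>x y. p (x + y) \<le> p x + p y)"

definition unit_ball :: "('v::real_vector \<Rightarrow> real) \<Rightarrow> 'v set" where
  "unit_ball p = {x. p x \<le> 1}"

definition bounded_functional :: "('v::real_vector \<Rightarrow> real) \<Rightarrow> ('v \<Rightarrow> real) \<Rightarrow> bool" where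
  "bounded_functional p f \<longleftrightarrow> linear f \<and> (\<exists>K. \<forall>x. \<bar>f x\<bar> \<le> K * p x)"

text \<open>Same formula as \<^const>\<open>onorm\<close>; the point \<open>x = 0\<close> contributes \<open>0 / 0 = 0\<close>.\<close>

definition dual_norm :: "('v::real_vector \<Rightarrow> real) \<Rightarrow> ('v \<Rightarrow> real) \<Rightarrow> real" where
  "dual_norm p f = (SUP x. \<bar>f x\<bar> / p x)"

definition dual_sphere :: "('v::real_vector \<Rightarrow> real) \<Rightarrow> ('v \<Rightarrow> real) set" where
  "dual_sphere p = {f. bounded_functional p f \<and> dual_norm p f = 1}"

definition slice :: "('v::real_vector \<Rightarrow> real) \<Rightarrow> ('v \<Rightarrow> real) \<Rightarrow> real \<Rightarrow> 'v set" where
  "slice p f \<alpha> = {x \<in> unit_ball p. f x > 1 - \<alpha>}"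

definition is_slice :: "('v::real_vector \<Rightarrow> real) \<Rightarrow> 'v set \<Rightarrow> bool" where
  "is_slice p S \<longleftrightarrow> (\<exists>f \<in> dual_sphere p. \<exists>\<alpha>>0. S = slice p f \<alpha>)"

definition SSD2P :: "('v::real_vector \<Rightarrow> real) \<Rightarrow> bool" where
  "SSD2P p \<longleftrightarrow>
     (\<forall>(n::nat) (S :: nat \<Rightarrow> 'v set) (\<epsilon>::real).
        n \<ge> 1 \<longrightarrow> (\<forall>i\<in>{1..n}. is_slice p (S i)) \<longrightarrow> \<epsilon> > 0 \<longrightarrow>
        (\<exists>(x :: nat \<Rightarrow> 'v) y.
           y \<in> unit_ball p \<and> p y > 1 - \<epsilon> \<and>
           (\<forall>i\<in>{1..n}. x i \<in> S i \<and> x i + y \<in> S i \<and> x i - y \<in> S i)))"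

definition absolute_normalized_norm :: "(real \<times> real \<Rightarrow> real) \<Rightarrow> bool" where
  "absolute_normalized_norm N \<longleftrightarrow>
     is_norm N \<and> (\<forall>a b. N (a, b) = N (\<bar>a\<bar>, \<bar>b\<bar>)) \<and> N (1, 0) = 1 \<and> N (0, 1) = 1"

definition linf_norm :: "real \<times> real \<Rightarrow> real" where
  "linf_norm = (\<lambda>(a, b). max \<bar>a\<bar> \<bar>b\<bar>)"

text \<open>The norm of \<open>X \<oplus>\<^sub>N Y\<close> on the vector space \<open>X \<times> Y\<close>.\<close>

definition sum_norm ::
  "(real \<times> real \<Rightarrow> real) \<Rightarrow> 'a::real_normed_vector \<times> 'b::real_normed_vector \<Rightarrow> real" where
  "sum_norm N = (\<lambda>(x, y). N (norm x, norm y))"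

lemma is_norm_norm: "is_norm (norm :: 'a::real_normed_vector \<Rightarrow> real)"
  by (simp add: is_norm_def norm_triangle_ineq)

lemma unit_ball_norm: "unit_ball (norm :: 'a::real_normed_vector \<Rightarrow> real) = cball 0 1"
  by (auto simp: unit_ball_def)

lemma bounded_functional_norm: "bounded_functional norm f \<longleftrightarrow> bounded_linear f"
  by (auto simp: bounded_functional_def bounded_linear_def bounded_linear_axioms_def mult.commute)

lemma dual_norm_norm: "dual_norm norm f = onorm f"
  by (simp add: dual_norm_def onorm_def)

lemma absolute_normalized_linf_norm: "absolute_normalized_norm linf_norm"
  by (auto simp: absolute_normalized_norm_def is_norm_def linf_norm_def zero_prod_def abs_mult
      max_mult_distrib_left split: prod.splits)

end

theory Submission
  imports Defs
begin

text \<open>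
  A norm-one functional on \<open>X\<close> or \<open>Y\<close>, composed with the coordinate projection, is a norm-one
  functional on every absolute sum of \<open>X\<close> and \<open>Y\<close> (\<open>dual_sphere_fst\<close>, \<open>dual_sphere_snd\<close>).
  So slices of the two unit balls lift to slices of the ball of the sum.

  For the maximum norm, let \<open>X\<close> and \<open>Y\<close> both fail the SSD2P, and lift two finite families of
  slices that witness this. If the sum had the SSD2P, the union of the lifted families would be
  translated symmetrically by a vector \<open>(u, v)\<close> of norm close to 1. One of \<open>u\<close>, \<open>v\<close> has the
  same norm, and that coordinate contradicts one of the two failures (\<open>SSD2P_linf_sum_imp\<close>).
  Conversely, the dual norm of the maximum norm adds the norms of the two coordinates of a
  functional. If \<open>X\<close> has the SSD2P, a slice of the ball of the sum therefore contains the product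
  of a slice of each unit ball; the points of \<open>Y\<close> may stay fixed, and the common vector is
  \<open>(u, 0)\<close> (\<open>SSD2P_linf_sum_of_left\<close>).

  For any other absolute norm \<open>N\<close>, two slices suffice for a contradiction, one lifted from each
  coordinate (\<open>not_SSD2P_absolute_sum\<close>). In the slice lifted from \<open>X\<close>, both points
  \<open>(x, y) \<plusminus> (u, v)\<close> have a first coordinate of norm almost 1. Averaging the two gives
  \<open>N (1, \<parallel>v\<parallel>) \<le> 1\<close> up to a small error, and likewise \<open>N (\<parallel>u\<parallel>, 1) \<le> 1\<close>.
  Since \<open>N (1, 1) > 1\<close>, both \<open>\<parallel>u\<parallel>\<close> and \<open>\<parallel>v\<parallel>\<close> stay away from 1. The midpoint of
  \<open>(1, \<parallel>v\<parallel>)\<close> and \<open>(\<parallel>u\<parallel>, 1)\<close> lies in the ball of \<open>N\<close> and exceeds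
  \<open>(\<parallel>u\<parallel>, \<parallel>v\<parallel>)\<close> by a fixed factor in both coordinates, so \<open>(u, v)\<close> cannot have norm
  close to 1.

  The last argument needs a norm-one functional on each space. It comes from the Hahn-Banach
  theorem, obtained here from minimal sublinear functionals; without such functionals there would
  be no slices, and the SSD2P would hold vacuously.
\<close>

section \<open>The Hahn-Banach theorem\<close>

definition sublinear :: "('v::real_vector \<Rightarrow> real) \<Rightarrow> bool" where
  "sublinear q \<longleftrightarrow>
     (\<forall>x y. q (x + y) \<le> q x + q y) \<and> (\<forall>c\<ge>0. \<forall>x. q (c *\<^sub>R x) = c * q x)"

lemma sublinear_add: "sublinear q \<Longrightarrow> q (x + y) \<le> q x + q y"
  by (simp add: sublinear_def)

lemma sublinear_scale: "sublinear q \<Longrightarrow> c \<ge> 0 \<Longrightarrow> q (c *\<^sub>R x) = c * q x"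
  by (simp add: sublinear_def)

lemma sublinear_zero: "sublinear q \<Longrightarrow> q 0 = 0"
  using sublinear_scale[of q 0 0] by simp

lemma sublinear_minus_ge: "sublinear q \<Longrightarrow> - q (- x) \<le> q x"
  using sublinear_add[of q x "- x"] sublinear_zero[of q] by simp

lemma sublinear_norm: "sublinear (norm :: 'a::real_normed_vector \<Rightarrow> real)"
  by (simp add: sublinear_def norm_triangle_ineq)

text \<open>
  A pointwise infimum of sublinear functionals is in general not subadditive. It is enough that the
  family as a whole absorbs sums and scalings, even if its members are not sublinear themselves.
  This covers both the infimum over a chain and the infimum over a ray.
\<close>

lemma sublinear_INF:
  fixes F :: "'i \<Rightarrow> 'v::real_vector \<Rightarrow> real"
  assumes ne: "I \<noteq> {}"
    and bdd: "\<And>x. bdd_below ((\<lambda>i. F i x) ` I)"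
    and add: "\<And>i j x y. i \<in> I \<Longrightarrow> j \<in> I \<Longrightarrow> \<exists>k\<in>I. F k (x + y) \<le> F i x + F j y"
    and scale: "\<And>i c x. i \<in> I \<Longrightarrow> c > 0 \<Longrightarrow> \<exists>k\<in>I. F k (c *\<^sub>R x) \<le> c * F i x"
    and zero: "\<And>i. i \<in> I \<Longrightarrow> F i 0 = 0"
  shows "sublinear (\<lambda>x. INF i\<in>I. F i x)"
proof -
  define G where "G x = (INF i\<in>I. F i x)" for x
  have lower: "G x \<le> F i x" if "i \<in> I" for i x
    unfolding G_def by (rule cINF_lower[OF bdd that])
  have greatest: "m \<le> G x" if "\<And>i. i \<in> I \<Longrightarrow> m \<le> F i x" for m x
    unfolding G_def by (rule cINF_greatest[OF ne that])
  have G_add: "G (x + y) \<le> G x + G y" for x y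
  proof -
    have "G (x + y) - F i x \<le> F j y" if ij: "i \<in> I" "j \<in> I" for i j
    proof -
      obtain k where "k \<in> I" "F k (x + y) \<le> F i x + F j y" using add[OF ij] by blast
      then show ?thesis using lower[of k "x + y"] by linarith
    qed
    then have le: "G (x + y) - F i x \<le> G y" if "i \<in> I" for i
      using that by (intro greatest)
    have "G (x + y) - G y \<le> G x"
    proof (rule greatest)
      show "G (x + y) - G y \<le> F i x" if "i \<in> I" for i
        using le[OF that] by simp
    qed
    then show ?thesis by simp
  qed
  have G_scale_le: "G (c *\<^sub>R x) \<le> c * G x" if "c > 0" for c x
  proof -
    have "G (c *\<^sub>R x) \<le> c * F i x" if "i \<in> I" for i
      using scale[OF that \<open>c > 0\<close>] lower by (meson order_trans)
    then have "G (c *\<^sub>R x) / c \<le> G x"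
      using \<open>c > 0\<close> by (intro greatest) (simp add: field_simps)
    then show ?thesis using \<open>c > 0\<close> by (simp add: field_simps)
  qed
  have "G 0 = 0"
    unfolding G_def using ne zero by simp
  moreover have "G (c *\<^sub>R x) = c * G x" if "c > 0" for c x
  proof (rule antisym[OF G_scale_le[OF that]])
    show "c * G x \<le> G (c *\<^sub>R x)"
      using G_scale_le[of "inverse c" "c *\<^sub>R x"] that by (simp add: field_simps)
  qed
  ultimately have "G (c *\<^sub>R x) = c * G x" if "c \<ge> 0" for c x
    using that by (cases "c = 0") auto
  with G_add have "sublinear G" by (simp add: sublinear_def)
  then show ?thesis by (simp add: G_def[abs_def])
qed

text \<open>
  Lowers \<open>q\<close> as far as possible along the ray through \<open>z\<close>, by the formula
  \<open>r x = (INF t\<ge>0. q (x + t *\<^sub>R z) - t * q z)\<close>. The last conclusion is the term \<open>t = 1\<close>; the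
  term \<open>t = 0\<close> gives \<open>r \<le> q\<close>.
\<close>

lemma sublinear_lower_in_direction:
  assumes q: "sublinear q"
  obtains r where "sublinear r" "r \<le> q" "\<And>x. r x \<le> q (x + z) - q z"
proof -
  define F where "F t x = q (x + t *\<^sub>R z) - t * q z" for t x
  define r where "r x = (INF t\<in>{0..}. F t x)" for x
  have bdd: "bdd_below ((\<lambda>t. F t x) ` {0..})" for x
  proof (rule bdd_belowI2)
    fix t :: real assume "t \<in> {0..}"
    then show "- q (- x) \<le> F t x"
      using sublinear_add[OF q, of "x + t *\<^sub>R z" "- x"] sublinear_scale[OF q, of t z]
      by (simp add: F_def)
  qed
  have "sublinear r"
    unfolding r_def
  proof (rule sublinear_INF)
    show "bdd_below ((\<lambda>t. F t x) ` {0..})" for x by (rule bdd)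
    show "\<exists>k\<in>{0..}. F k (x + y) \<le> F s x + F t y" if "s \<in> {0..}" "t \<in> {0..}" for s t x y
    proof (rule bexI)
      show "F (s + t) (x + y) \<le> F s x + F t y"
        using sublinear_add[OF q, of "x + s *\<^sub>R z" "y + t *\<^sub>R z"]
        by (simp add: F_def algebra_simps)
    qed (use that in simp)
    show "\<exists>k\<in>{0..}. F k (c *\<^sub>R x) \<le> c * F t x" if "t \<in> {0..}" "c > 0" for t c x
    proof (rule bexI)
      show "F (c * t) (c *\<^sub>R x) \<le> c * F t x"
        using sublinear_scale[OF q, of c "x + t *\<^sub>R z"] that
        by (simp add: F_def algebra_simps)
    qed (use that in simp)
    show "F t 0 = 0" if "t \<in> {0..}" for t
      using that by (simp add: F_def sublinear_scale[OF q])
  qed auto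
  moreover have "r \<le> q"
    unfolding r_def le_fun_def using cINF_lower[OF bdd, of 0] by (simp add: F_def)
  moreover have "r x \<le> q (x + z) - q z" for x
    unfolding r_def using cINF_lower[OF bdd, of 1] by (simp add: F_def)
  ultimately show ?thesis by (rule that)
qed

text \<open>
  If \<open>q\<close> cannot be lowered in any direction, then \<open>q x \<le> q (x + z) - q z\<close>, which is the missing
  half of additivity.
\<close>

lemma minimal_sublinear_imp_linear:
  assumes q: "sublinear q"
    and minimal: "\<And>r. sublinear r \<Longrightarrow> r \<le> q \<Longrightarrow> r = q"
  shows "linear q"
proof -
  have add: "q (x + z) = q x + q z" for x z
  proof -
    obtain r where "sublinear r" "r \<le> q" "\<And>x. r x \<le> q (x + z) - q z"
      using sublinear_lower_in_direction[OF q, of z] by blast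
    then have "q x \<le> q (x + z) - q z" using minimal by metis
    with sublinear_add[OF q, of x z] show ?thesis by simp
  qed
  have minus: "q (- x) = - q x" for x
    using add[of x "- x"] sublinear_zero[OF q] by simp
  have "q (c *\<^sub>R x) = c * q x" for c x
  proof (cases "c \<ge> 0")
    case False
    then show ?thesis
      using sublinear_scale[OF q, of "- c" x] minus[of "c *\<^sub>R x"] by simp
  qed (rule sublinear_scale[OF q])
  with add show ?thesis by (intro linearI) auto
qed

text \<open>
  Zorn's lemma. Every sublinear functional below \<open>p\<close> is at least \<open>- p (- x)\<close> at \<open>x\<close>, so the
  pointwise infimum of a chain is finite.
\<close>

lemma minimal_sublinear_exists:
  assumes p: "sublinear p"
  obtains q where "sublinear q" "q \<le> p" "\<And>r. sublinear r \<Longrightarrow> r \<le> q \<Longrightarrow> r = q"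
proof -
  define A where "A = {q. sublinear q \<and> q \<le> p}"
  have "\<exists>m\<in>A. \<forall>a\<in>A. m \<ge> a \<longrightarrow> a = m"
  proof (rule predicate_Zorn)
    show "partial_order_on A (relation_of (\<ge>) A)"
      by (rule partial_order_on_relation_ofI) auto
    fix C assume C: "C \<in> Chains (relation_of (\<ge>) A)"
    then have CA: "C \<subseteq> A" by (rule Chains_relation_of)
    have total: "a \<le> b \<or> b \<le> a" if "a \<in> C" "b \<in> C" for a b
      using C that by (auto simp: Chains_def relation_of_def)
    show "\<exists>u\<in>A. \<forall>a\<in>C. a \<ge> u"
    proof (cases "C = {}")
      case True
      with p show ?thesis by (auto simp: A_def)
    next
      case False
      define u where "u x = (INF q\<in>C. q x)" for x
      have sub: "sublinear q" "q x \<le> p x" if "q \<in> C" for q x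
        using CA that by (auto simp: A_def le_fun_def)
      have bdd: "bdd_below ((\<lambda>q. q x) ` C)" for x
      proof (rule bdd_belowI2)
        fix q assume "q \<in> C"
        then show "- p (- x) \<le> q x"
          using sublinear_minus_ge[OF sub(1), of q x] sub(2)[of q "- x"] by simp
      qed
      have lower: "u x \<le> q x" if "q \<in> C" for q x
        unfolding u_def by (rule cINF_lower[OF bdd that])
      have "sublinear u"
        unfolding u_def
      proof (rule sublinear_INF[OF False bdd])
        fix a b x y assume ab: "a \<in> C" "b \<in> C"
        show "\<exists>k\<in>C. k (x + y) \<le> a x + b y"
          using total[OF ab]
        proof
          assume "a \<le> b"
          then have "a (x + y) \<le> a x + b y"
            using sublinear_add[OF sub(1)[OF ab(1)], of x y] by (auto simp: le_fun_def intro: order_trans)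
          with ab show ?thesis by blast
        next
          assume "b \<le> a"
          then have "b (x + y) \<le> a x + b y"
            using sublinear_add[OF sub(1)[OF ab(2)], of x y] by (auto simp: le_fun_def intro: order_trans)
          with ab show ?thesis by blast
        qed
      next
        fix a x and c :: real assume "a \<in> C" "c > 0"
        then show "\<exists>k\<in>C. k (c *\<^sub>R x) \<le> c * a x"
          using sublinear_scale[OF sub(1), of a c] by (intro bexI[of _ a]) auto
      qed (use sub sublinear_zero in blast)
      moreover have "u \<le> p"
      proof (rule le_funI)
        fix x
        obtain a where "a \<in> C" using False by blast
        then show "u x \<le> p x" using lower[of a x] sub(2)[of a x] by linarith
      qed
      ultimately show ?thesis
        using lower by (auto simp: A_def le_fun_def)
    qed
  qed
  then obtain q where q: "q \<in> A" "\<And>a. a \<in> A \<Longrightarrow> a \<le> q \<Longrightarrow> a = q" by blast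
  show ?thesis
  proof (rule that)
    show "sublinear q" "q \<le> p" using q by (auto simp: A_def)
    show "r = q" if "sublinear r" "r \<le> q" for r
      using that q \<open>q \<le> p\<close> by (auto simp: A_def)
  qed
qed

text \<open>
  Lowering \<open>p\<close> in the direction \<open>x\<^sub>0\<close> first forces the value at \<open>- x\<^sub>0\<close> down to at most
  \<open>- p x\<^sub>0\<close>. Every linear functional below the result therefore attains \<open>p x\<^sub>0\<close> at \<open>x\<^sub>0\<close>.
\<close>

lemma hahn_banach_supporting_functional:
  assumes p: "sublinear p"
  obtains f where "linear f" "\<And>x. f x \<le> p x" "f x\<^sub>0 = p x\<^sub>0"
proof -
  obtain r where r: "sublinear r" "r \<le> p" "\<And>x. r x \<le> p (x + x\<^sub>0) - p x\<^sub>0"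
    using sublinear_lower_in_direction[OF p, of x\<^sub>0] by blast
  obtain f where f: "sublinear f" "f \<le> r" "\<And>s. sublinear s \<Longrightarrow> s \<le> f \<Longrightarrow> s = f"
    using minimal_sublinear_exists[OF r(1)] by blast
  have lin: "linear f" by (rule minimal_sublinear_imp_linear[OF f(1,3)])
  have le: "f x \<le> p x" for x
    using f(2) r(2) by (meson le_funD order_trans)
  have "- f x\<^sub>0 \<le> r (- x\<^sub>0)"
    using le_funD[OF f(2), of "- x\<^sub>0"] linear_neg[OF lin, of "x\<^sub>0"] by simp
  also have "\<dots> \<le> - p x\<^sub>0"
    using r(3)[of "- x\<^sub>0"] sublinear_zero[OF p] by simp
  finally have "f x\<^sub>0 = p x\<^sub>0" using le[of x\<^sub>0] by simp
  with lin le show ?thesis by (rule that)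
qed

section \<open>Functionals of norm one\<close>

lemma is_norm_scale: "is_norm p \<Longrightarrow> p (c *\<^sub>R x) = \<bar>c\<bar> * p x"
  unfolding is_norm_def by blast

lemma is_norm_triangle: "is_norm p \<Longrightarrow> p (x + y) \<le> p x + p y"
  unfolding is_norm_def by blast

text \<open>
  The explicit supremum in the definition of the dual norm is meaningful only for a bounded set of
  quotients; \<open>dual_norm_bound\<close> and \<open>dual_norm_least\<close> reduce it to the best constant in
  \<open>\<bar>f x\<bar> \<le> c * p x\<close>.
\<close>

lemma dual_norm_bound:
  assumes "is_norm p" "bounded_functional p f"
  shows "\<bar>f x\<bar> \<le> dual_norm p f * p x"
proof -
  have p0: "p x \<ge> 0" for x using assms by (simp add: is_norm_def)
  obtain K where K: "\<And>x. \<bar>f x\<bar> \<le> K * p x"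
    using assms by (auto simp: bounded_functional_def)
  show ?thesis
  proof (cases "p x = 0")
    case True
    then show ?thesis using K[of x] by simp
  next
    case False
    have "bdd_above (range (\<lambda>x. \<bar>f x\<bar> / p x))"
    proof (rule bdd_aboveI2)
      fix x
      show "\<bar>f x\<bar> / p x \<le> \<bar>K\<bar>"
      proof (cases "p x = 0")
        case False
        have "K * p x \<le> \<bar>K\<bar> * p x" using p0 by (simp add: mult_right_mono)
        with K[of x] have "\<bar>f x\<bar> \<le> \<bar>K\<bar> * p x" by linarith
        with False p0[of x] show ?thesis by (simp add: divide_le_eq)
      qed simp
    qed
    then have "\<bar>f x\<bar> / p x \<le> dual_norm p f"
      unfolding dual_norm_def by (rule cSUP_upper[OF UNIV_I])
    with False p0[of x] show ?thesis by (simp add: divide_le_eq)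
  qed
qed

lemma dual_norm_least:
  assumes "is_norm p" "c \<ge> 0" "\<And>x. \<bar>f x\<bar> \<le> c * p x"
  shows "dual_norm p f \<le> c"
  unfolding dual_norm_def
proof (rule cSUP_least)
  fix x
  have "p x \<ge> 0" using assms by (simp add: is_norm_def)
  then show "\<bar>f x\<bar> / p x \<le> c"
    using assms(2) assms(3)[of x] by (cases "p x = 0") (auto simp: divide_le_eq)
qed simp

lemma dual_sphereD:
  assumes "is_norm p" "f \<in> dual_sphere p"
  shows "linear f" "\<bar>f x\<bar> \<le> p x"
    and "\<lbrakk>c \<ge> 0; \<And>x. \<bar>f x\<bar> \<le> c * p x\<rbrakk> \<Longrightarrow> 1 \<le> c"
  using assms dual_norm_bound[of p f x] dual_norm_least[of p c f]
  by (auto simp: dual_sphere_def bounded_functional_def)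

lemma dual_sphereI:
  fixes p :: "'v::real_vector \<Rightarrow> real" and z :: 'v
  assumes p: "is_norm p" and f: "linear f" "\<And>x. \<bar>f x\<bar> \<le> p x"
    and least: "\<And>c. \<lbrakk>c \<ge> 0; \<And>x. \<bar>f x\<bar> \<le> c * p x\<rbrakk> \<Longrightarrow> 1 \<le> c"
    and nontriv: "z \<noteq> 0"
  shows "f \<in> dual_sphere p"
proof -
  have bf: "bounded_functional p f"
    using f by (auto simp: bounded_functional_def intro!: exI[of _ 1])
  have bound: "\<bar>f x\<bar> \<le> dual_norm p f * p x" for x
    by (rule dual_norm_bound[OF p bf])
  have "p z > 0" using p nontriv by (metis is_norm_def less_eq_real_def)
  moreover have "0 \<le> dual_norm p f * p z" using bound[of z] by linarith
  ultimately have "dual_norm p f \<ge> 0" by (simp add: zero_le_mult_iff)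
  then have "1 \<le> dual_norm p f" using bound by (rule least)
  moreover have "dual_norm p f \<le> 1"
    by (rule dual_norm_least[OF p]) (use f in auto)
  ultimately show ?thesis using bf by (simp add: dual_sphere_def)
qed

lemma dual_sphere_nonempty:
  fixes z :: "'a::real_normed_vector"
  assumes "z \<noteq> 0"
  obtains f :: "'a \<Rightarrow> real" where "f \<in> dual_sphere norm"
proof -
  obtain f where f: "linear f" "\<And>x. f x \<le> norm x" "f z = norm z"
    using hahn_banach_supporting_functional[OF sublinear_norm, of z] by blast
  have "f \<in> dual_sphere norm"
  proof (rule dual_sphereI[OF is_norm_norm f(1) _ _ assms])
    show "\<bar>f x\<bar> \<le> norm x" for x
      using f(2)[of x] f(2)[of "- x"] linear_neg[OF f(1), of x] by simp
    show "1 \<le> c" if "\<And>x. \<bar>f x\<bar> \<le> c * norm x" for c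
      using that[of z] f(3) assms by simp
  qed
  then show ?thesis by (rule that)
qed

text \<open>
  A contraction \<open>P\<close> with a norm-nonincreasing section \<open>J\<close> maps the unit ball onto the unit ball,
  so composition with \<open>P\<close> preserves dual norms. Coordinate projections of absolute sums and
  isometric isomorphisms are the instances of interest.
\<close>

lemma dual_sphere_comp_retraction:
  fixes P :: "'w::real_vector \<Rightarrow> 'v::real_vector"
  assumes p: "is_norm p" and q: "is_norm q" and f: "f \<in> dual_sphere p"
    and P: "linear P" "\<And>w. p (P w) \<le> q w"
    and J: "\<And>x. P (J x) = x" "\<And>x. q (J x) \<le> p x"
  shows "f \<circ> P \<in> dual_sphere q"
proof -
  note D = dual_sphereD[OF p f]
  obtain x where "f x \<noteq> 0" using D(3)[of 0] by fastforce
  then have "x \<noteq> 0" using linear_0[OF D(1)] by auto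
  then have "J x \<noteq> 0" using J(1)[of x] linear_0[OF P(1)] by auto
  with q _ _ _ show ?thesis
  proof (rule dual_sphereI)
    show "linear (f \<circ> P)" by (rule linear_compose[OF P(1) D(1)])
    show "\<bar>(f \<circ> P) w\<bar> \<le> q w" for w
      using D(2)[of "P w"] P(2)[of w] by simp
    fix c :: real assume c: "c \<ge> 0" "\<And>w. \<bar>(f \<circ> P) w\<bar> \<le> c * q w"
    show "1 \<le> c"
    proof (rule D(3)[OF c(1)])
      show "\<bar>f x\<bar> \<le> c * p x" for x
        using c(2)[of "J x"] mult_left_mono[OF J(2)[of x] c(1)] J(1)[of x] by simp
    qed
  qed
qed

section \<open>Absolute sums\<close>

lemma absolute_norm_is_norm: "absolute_normalized_norm N \<Longrightarrow> is_norm N"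
  by (simp add: absolute_normalized_norm_def)

lemma absolute_norm_abs: "absolute_normalized_norm N \<Longrightarrow> N (\<bar>a\<bar>, \<bar>b\<bar>) = N (a, b)"
  unfolding absolute_normalized_norm_def by metis

lemmas absolute_norm_scale = is_norm_scale[OF absolute_norm_is_norm]
lemmas absolute_norm_triangle = is_norm_triangle[OF absolute_norm_is_norm]

text \<open>
  For \<open>0 \<le> a \<le> a'\<close> the point \<open>(a, b)\<close> is a convex combination of the two points
  \<open>(a', b)\<close> and \<open>(- a', b)\<close>, which have equal norm. One coordinate is raised at a time.
\<close>

lemma absolute_norm_mono:
  assumes N: "absolute_normalized_norm N"
    and le: "0 \<le> a" "a \<le> a'" "0 \<le> b" "b \<le> b'"
  shows "N (a, b) \<le> N (a', b')"
proof -
  note scale = absolute_norm_scale[OF N] and tri = absolute_norm_triangle[OF N]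
    and abs = absolute_norm_abs[OF N]
  have convex: "N (l *\<^sub>R z + (1 - l) *\<^sub>R w) \<le> N z" if "N w = N z" "0 \<le> l" "l \<le> 1" for l z w
    using tri[of "l *\<^sub>R z" "(1 - l) *\<^sub>R w"] that by (simp add: scale left_diff_distrib)
  have "N (a, b) \<le> N (a', b)"
  proof (cases "a' = 0")
    case False
    have "(a, b) = ((1 + a / a') / 2) *\<^sub>R (a', b) + (1 - (1 + a / a') / 2) *\<^sub>R (- a', b)"
      using False by (simp add: field_simps)
    moreover have "N (- a', b) = N (a', b)" using abs[of "- a'" b] abs[of a' b] by simp
    ultimately show ?thesis
      using convex[of "(- a', b)" "(a', b)" "(1 + a / a') / 2"] le False by (simp add: field_simps)
  qed (use le in simp)
  also have "N (a', b) \<le> N (a', b')"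
  proof (cases "b' = 0")
    case False
    have "(a', b) = ((1 + b / b') / 2) *\<^sub>R (a', b') + (1 - (1 + b / b') / 2) *\<^sub>R (a', - b')"
      using False by (simp add: field_simps)
    moreover have "N (a', - b') = N (a', b')" using abs[of a' "- b'"] abs[of a' b'] by simp
    ultimately show ?thesis
      using convex[of "(a', - b')" "(a', b')" "(1 + b / b') / 2"] le False by (simp add: field_simps)
  qed (use le in simp)
  finally show ?thesis .
qed

lemma absolute_norm_axis:
  assumes N: "absolute_normalized_norm N"
  shows "N (a, 0) = \<bar>a\<bar>" "N (0, b) = \<bar>b\<bar>"
  using absolute_norm_scale[OF N, of a "(1, 0)"] absolute_norm_scale[OF N, of b "(0, 1)"] N
  by (simp_all add: absolute_normalized_norm_def)

lemma absolute_norm_ge: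
  assumes N: "absolute_normalized_norm N"
  shows "\<bar>a\<bar> \<le> N (a, b)" "\<bar>b\<bar> \<le> N (a, b)"
  using absolute_norm_mono[OF N, of "\<bar>a\<bar>" "\<bar>a\<bar>" 0 "\<bar>b\<bar>"]
    absolute_norm_mono[OF N, of 0 "\<bar>a\<bar>" "\<bar>b\<bar>" "\<bar>b\<bar>"]
  by (simp_all add: absolute_norm_abs[OF N] absolute_norm_axis[OF N])

lemma is_norm_sum_norm:
  assumes N: "absolute_normalized_norm N"
  shows "is_norm (sum_norm N :: 'a::real_normed_vector \<times> 'b::real_normed_vector \<Rightarrow> real)"
  unfolding is_norm_def
proof (intro conjI allI)
  note scale = absolute_norm_scale[OF N] and tri = absolute_norm_triangle[OF N]
  have nonneg: "0 \<le> N w" and definite: "N w = 0 \<longleftrightarrow> w = 0" for w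
    using absolute_norm_is_norm[OF N] unfolding is_norm_def by blast+
  fix z w :: "'a \<times> 'b" and c :: real
  obtain x y x' y' where zw: "z = (x, y)" "w = (x', y')" by fastforce
  show "0 \<le> sum_norm N z" by (simp add: zw sum_norm_def nonneg)
  show "sum_norm N z = 0 \<longleftrightarrow> z = 0"
    by (simp add: zw sum_norm_def definite zero_prod_def)
  show "sum_norm N (c *\<^sub>R z) = \<bar>c\<bar> * sum_norm N z"
    using scale[of "\<bar>c\<bar>" "(norm x, norm y)"] by (simp add: zw sum_norm_def)
  have "N (norm (x + x'), norm (y + y')) \<le> N (norm x + norm x', norm y + norm y')"
    by (intro absolute_norm_mono[OF N] norm_triangle_ineq) auto
  also have "\<dots> \<le> N (norm x, norm y) + N (norm x', norm y')"
    using tri[of "(norm x, norm y)" "(norm x', norm y')"] by simp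
  finally show "sum_norm N (z + w) \<le> sum_norm N z + sum_norm N w"
    by (simp add: zw sum_norm_def)
qed

lemma norm_component_le_sum_norm:
  assumes N: "absolute_normalized_norm N"
  shows "norm (fst z) \<le> sum_norm N z" "norm (snd z) \<le> sum_norm N z"
  using absolute_norm_ge[OF N, where a = "norm (fst z)" and b = "norm (snd z)"]
  by (simp_all add: sum_norm_def case_prod_beta)

lemma sum_norm_axis:
  assumes N: "absolute_normalized_norm N"
  shows "sum_norm N (x, 0) = norm x" "sum_norm N (0, y) = norm y"
  by (simp_all add: sum_norm_def absolute_norm_axis[OF N])

lemma dual_sphere_fst:
  assumes N: "absolute_normalized_norm N" and f: "f \<in> dual_sphere norm"
  shows "f \<circ> fst \<in> dual_sphere (sum_norm N)"
  by (rule dual_sphere_comp_retraction[where J = "\<lambda>x. (x, 0)",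
        OF is_norm_norm is_norm_sum_norm[OF N] f])
    (simp_all add: linear_fst norm_component_le_sum_norm[OF N] sum_norm_axis[OF N])

lemma dual_sphere_snd:
  assumes N: "absolute_normalized_norm N" and f: "f \<in> dual_sphere norm"
  shows "f \<circ> snd \<in> dual_sphere (sum_norm N)"
  by (rule dual_sphere_comp_retraction[where J = "\<lambda>y. (0, y)",
        OF is_norm_norm is_norm_sum_norm[OF N] f])
    (simp_all add: linear_snd norm_component_le_sum_norm[OF N] sum_norm_axis[OF N])


section \<open>The symmetric strong diameter 2 property\<close>

lemma SSD2P_iff:
  "SSD2P p \<longleftrightarrow>
     (\<forall>(n::nat) f \<alpha> \<epsilon>. n \<ge> 1 \<longrightarrow> (\<forall>i\<in>{1..n}. f i \<in> dual_sphere p \<and> \<alpha> i > 0) \<longrightarrow> \<epsilon> > 0 \<longrightarrow>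
        (\<exists>x y. p y \<le> 1 \<and> p y > 1 - \<epsilon> \<and>
           (\<forall>i\<in>{1..n}. {x i, x i + y, x i - y} \<subseteq> slice p (f i) (\<alpha> i))))"
  (is "_ \<longleftrightarrow> ?R")
proof
  assume L: "SSD2P p"
  show ?R
  proof (intro allI impI)
    fix n :: nat and f and \<alpha> :: "nat \<Rightarrow> real" and \<epsilon> :: real
    assume A: "n \<ge> 1" "\<forall>i\<in>{1..n}. f i \<in> dual_sphere p \<and> \<alpha> i > 0" "\<epsilon> > 0"
    then have "\<forall>i\<in>{1..n}. is_slice p (slice p (f i) (\<alpha> i))"
      unfolding is_slice_def by blast
    from L[unfolded SSD2P_def, rule_format, OF A(1) this[rule_format] A(3)]
    show "\<exists>x y. p y \<le> 1 \<and> p y > 1 - \<epsilon> \<and>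
        (\<forall>i\<in>{1..n}. {x i, x i + y, x i - y} \<subseteq> slice p (f i) (\<alpha> i))"
      by (auto simp: unit_ball_def)
  qed
next
  assume R: ?R
  show "SSD2P p"
    unfolding SSD2P_def
  proof (intro allI impI)
    fix n :: nat and S and \<epsilon> :: real
    assume A: "n \<ge> 1" "\<forall>i\<in>{1..n}. is_slice p (S i)" "\<epsilon> > 0"
    then have "\<forall>i\<in>{1..n}. \<exists>f\<alpha>. fst f\<alpha> \<in> dual_sphere p \<and> snd f\<alpha> > 0 \<and> S i = slice p (fst f\<alpha>) (snd f\<alpha>)"
      unfolding is_slice_def by fastforce
    then obtain h where h: "\<forall>i\<in>{1..n}. fst (h i) \<in> dual_sphere p \<and> snd (h i) > 0
        \<and> S i = slice p (fst (h i)) (snd (h i))"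
      by (metis bchoice)
    from R[rule_format, OF A(1) _ A(3), of "\<lambda>i. fst (h i)" "\<lambda>i. snd (h i)"] h
    obtain x y where "p y \<le> 1" "p y > 1 - \<epsilon>"
      "\<forall>i\<in>{1..n}. {x i, x i + y, x i - y} \<subseteq> slice p (fst (h i)) (snd (h i))"
      by blast
    with h show "\<exists>x y. y \<in> unit_ball p \<and> p y > 1 - \<epsilon> \<and>
        (\<forall>i\<in>{1..n}. x i \<in> S i \<and> x i + y \<in> S i \<and> x i - y \<in> S i)"
      by (intro exI[of _ x] exI[of _ y]) (auto simp: unit_ball_def)
  qed
qed

lemma SSD2P_obtain:
  assumes "SSD2P p" "n \<ge> (1::nat)" "\<forall>i\<in>{1..n}. f i \<in> dual_sphere p \<and> \<alpha> i > 0" "\<epsilon> > 0"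
  obtains x y where "p y \<le> 1" "p y > 1 - \<epsilon>"
    "\<forall>i\<in>{1..n}. {x i, x i + y, x i - y} \<subseteq> slice p (f i) (\<alpha> i)"
  using assms(1)[unfolded SSD2P_iff, THEN spec, THEN spec, THEN spec, THEN spec,
      THEN mp, THEN mp, THEN mp, OF assms(2-4)] by blast

lemma not_SSD2P_obtain:
  assumes "\<not> SSD2P p"
  obtains n :: nat and f \<alpha> \<epsilon> where "n \<ge> 1" "\<forall>i\<in>{1..n}. f i \<in> dual_sphere p \<and> \<alpha> i > 0" "\<epsilon> > 0"
    "\<nexists>x y. p y \<le> 1 \<and> p y > 1 - \<epsilon> \<and>
       (\<forall>i\<in>{1..n}. {x i, x i + y, x i - y} \<subseteq> slice p (f i) (\<alpha> i))"
  using assms unfolding SSD2P_iff not_all not_imp by (elim exE conjE) (rule that)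

lemma SSD2P_isometric:
  fixes T :: "'v::real_vector \<Rightarrow> 'w::real_vector"
  assumes p: "is_norm p" and q: "is_norm q"
    and T: "linear T" "\<And>v. q (T v) = p v" and S: "\<And>w. T (S w) = w"
    and SSD: "SSD2P p"
  shows "SSD2P q"
  unfolding SSD2P_iff
proof (intro allI impI)
  fix n :: nat and f and \<alpha> :: "nat \<Rightarrow> real" and \<epsilon> :: real
  assume A: "n \<ge> 1" "\<forall>i\<in>{1..n}. f i \<in> dual_sphere q \<and> \<alpha> i > 0" "\<epsilon> > 0"
  have pS: "p (S w) = q w" for w
    using T(2)[of "S w"] by (simp add: S)
  have "f i \<circ> T \<in> dual_sphere p" if "f i \<in> dual_sphere q" for i
    by (rule dual_sphere_comp_retraction[where J = S, OF q p that T(1)])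
      (simp_all add: T(2) S pS)
  with A(2) have fT: "\<forall>i\<in>{1..n}. f i \<circ> T \<in> dual_sphere p \<and> \<alpha> i > 0"
    by simp
  obtain x y where y: "p y \<le> 1" "p y > 1 - \<epsilon>"
    and x: "\<forall>i\<in>{1..n}. {x i, x i + y, x i - y} \<subseteq> slice p (f i \<circ> T) (\<alpha> i)"
    by (rule SSD2P_obtain[where f = "\<lambda>i. f i \<circ> T" and \<alpha> = \<alpha>, OF SSD A(1) fT A(3)])
      (rule that)
  show "\<exists>x y. q y \<le> 1 \<and> q y > 1 - \<epsilon> \<and>
      (\<forall>i\<in>{1..n}. {x i, x i + y, x i - y} \<subseteq> slice q (f i) (\<alpha> i))"
    by (rule exI[of _ "\<lambda>i. T (x i)"], rule exI[of _ "T y"])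
      (use x y in \<open>auto simp: T(2) slice_def unit_ball_def
          linear_add[OF T(1), symmetric] linear_diff[OF T(1), symmetric]\<close>)
qed

text \<open>
  The functionals that a functional on the sum induces on the two coordinates do not have norm one,
  so they have to be normalized before a slice can be formed.
\<close>

lemma normalized_in_dual_sphere:
  fixes f :: "'a::real_normed_vector \<Rightarrow> real"
  assumes f: "bounded_linear f" and nz: "onorm f \<noteq> 0"
  shows "(\<lambda>x. f x / onorm f) \<in> dual_sphere norm"
proof -
  have pos: "onorm f > 0" using onorm_pos_le[OF f] nz by linarith
  have "bounded_linear (\<lambda>x. f x / onorm f)"
    using bounded_linear_compose[OF bounded_linear_divide f] .
  moreover have "onorm (\<lambda>x. f x / onorm f) = 1"
    using onorm_scaleR[OF f, of "inverse (onorm f)"] pos by (simp add: field_simps)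
  ultimately show ?thesis
    by (simp add: dual_sphere_def bounded_functional_norm dual_norm_norm)
qed

lemma onorm_almost_attained:
  fixes f :: "'a::real_normed_vector \<Rightarrow> real"
  assumes f: "bounded_linear f" and "\<delta> > 0"
  shows "\<exists>x. norm x \<le> 1 \<and> f x > onorm f - \<delta>"
proof (rule ccontr)
  assume *: "\<nexists>x. norm x \<le> 1 \<and> f x > onorm f - \<delta>"
  define c where "c = onorm f - \<delta>"
  have le: "f x \<le> c" if "norm x \<le> 1" for x
    using * that by (auto simp: c_def not_less)
  interpret f: bounded_linear f by (rule f)
  have c: "c \<ge> 0" using le[of 0] by (simp add: f.zero)
  have "\<bar>f x\<bar> \<le> c * norm x" for x
  proof (cases "x = 0")
    case False
    have "f (x /\<^sub>R norm x) \<le> c" "f (- x /\<^sub>R norm x) \<le> c" using False by (auto intro: le)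
    then have "f x / norm x \<le> c" "- f x / norm x \<le> c"
      by (simp_all add: f.scaleR f.neg divide_inverse mult.commute)
    then show ?thesis using False by (auto simp: field_simps abs_le_iff)
  qed (simp add: f.zero)
  then have "onorm f \<le> c" using c by (intro onorm_bound) auto
  then show False using \<open>\<delta> > 0\<close> by (simp add: c_def)
qed

text \<open>
  The SSD2P tested against arbitrary bounded functionals instead of norm-one functionals. A zero
  functional defines no slice but imposes no condition either, so any nonzero member of the family
  may take its place. If all vanish, only a unit vector is needed, and here \<open>z\<close> enters.
\<close>

lemma SSD2P_arbitrary_functionals:
  fixes f :: "nat \<Rightarrow> 'a::real_normed_vector \<Rightarrow> real"
  assumes SSD: "SSD2P (norm :: 'a \<Rightarrow> real)" and nontriv: "z \<noteq> (0::'a)"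
    and f: "\<And>i. i \<in> {1..n} \<Longrightarrow> bounded_linear (f i)"
    and \<alpha>: "\<And>i. i \<in> {1..n} \<Longrightarrow> \<alpha> i > 0" and \<epsilon>: "\<epsilon> > 0"
  obtains x y where "norm y \<le> 1" "norm y > 1 - \<epsilon>"
    "\<forall>i\<in>{1..n}. \<forall>w\<in>{x i, x i + y, x i - y}. norm w \<le> 1 \<and> f i w > onorm (f i) - \<alpha> i"
proof (cases "\<exists>j\<in>{1..n}. onorm (f j) \<noteq> 0")
  case False
  define y where "y = z /\<^sub>R norm z"
  have "norm y = 1" using nontriv by (simp add: y_def)
  moreover have "f i w = 0" if "i \<in> {1..n}" for i w
    using onorm_eq_0[OF f[OF that]] False that by blast
  ultimately show ?thesis
    using False \<alpha> \<epsilon> by (intro that[of y "\<lambda>_. 0"]) auto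
next
  case True
  then obtain j where j: "j \<in> {1..n}" "onorm (f j) \<noteq> 0" by blast
  \<comment> \<open>Index of the functional whose slice is used in place of the \<open>i\<close>-th one.\<close>
  define k where "k i = (if onorm (f i) = 0 then j else i)" for i
  have k: "k i \<in> {1..n}" "onorm (f (k i)) \<noteq> 0" if "i \<in> {1..n}" for i
    using that j by (auto simp: k_def)
  define g where "g i = (\<lambda>x. f (k i) x / onorm (f (k i)))" for i
  define \<beta> where "\<beta> i = \<alpha> (k i) / onorm (f (k i))" for i
  have pos: "onorm (f (k i)) > 0" if "i \<in> {1..n}" for i
    using onorm_pos_le[OF f] k[OF that] by (metis less_eq_real_def)
  have g: "\<forall>i\<in>{1..n}. g i \<in> dual_sphere norm \<and> \<beta> i > 0"
    using k pos f \<alpha> by (auto simp: g_def \<beta>_def intro!: normalized_in_dual_sphere)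
  have "n \<ge> 1" using j by simp
  obtain x y where y: "norm y \<le> 1" "norm y > 1 - \<epsilon>"
    and x: "\<forall>i\<in>{1..n}. {x i, x i + y, x i - y} \<subseteq> slice norm (g i) (\<beta> i)"
    by (rule SSD2P_obtain[where f = g and \<alpha> = \<beta>, OF SSD \<open>n \<ge> 1\<close> g \<epsilon>])
      (rule that)
  show ?thesis
  proof (rule that[OF y], intro ballI)
    fix i w assume i: "i \<in> {1..n}" and "w \<in> {x i, x i + y, x i - y}"
    with x have w: "w \<in> slice norm (g i) (\<beta> i)" by blast
    have "f i w > onorm (f i) - \<alpha> i"
    proof (cases "onorm (f i) = 0")
      case True
      then show ?thesis using onorm_eq_0[OF f[OF i]] \<alpha>[OF i] by simp
    next
      case False
      then have "k i = i" by (simp add: k_def)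
      with w pos[OF i] show ?thesis by (simp add: slice_def g_def \<beta>_def field_simps)
    qed
    with w show "norm w \<le> 1 \<and> f i w > onorm (f i) - \<alpha> i"
      by (simp add: slice_def unit_ball_def)
  qed
qed

section \<open>The maximum norm\<close>

lemma sum_norm_linf: "sum_norm linf_norm (x, y) = max (norm x) (norm y)"
  by (simp add: sum_norm_def linf_norm_def)

text \<open>
  A functional \<open>h\<close> of norm one on the sum splits as \<open>f\<close> on \<open>X\<close> plus \<open>g\<close> on \<open>Y\<close> with
  \<open>onorm f + onorm g \<ge> 1\<close>. It suffices to come within \<open>\<alpha> / 2\<close> of each of the two norms:
  on \<open>X\<close> with the common vector \<open>u\<close> given by the SSD2P, on \<open>Y\<close> with a single point.
\<close>

lemma SSD2P_linf_sum_of_left: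
  fixes z :: "'a::real_normed_vector"
  assumes SSD: "SSD2P (norm :: 'a \<Rightarrow> real)" and nontriv: "z \<noteq> 0"
  shows "SSD2P (sum_norm linf_norm :: 'a \<times> 'b::real_normed_vector \<Rightarrow> real)"
  unfolding SSD2P_iff
proof (intro allI impI)
  let ?q = "sum_norm linf_norm :: 'a \<times> 'b \<Rightarrow> real"
  fix n :: nat and h and \<alpha> :: "nat \<Rightarrow> real" and \<epsilon> :: real
  assume A: "n \<ge> 1" "\<forall>i\<in>{1..n}. h i \<in> dual_sphere ?q \<and> \<alpha> i > 0" "\<epsilon> > 0"
  define f where "f i x = h i (x, 0)" for i x
  define g where "g i y = h i (0, y)" for i y
  have fg: "bounded_linear (f i)" "bounded_linear (g i)"
    "h i (x, y) = f i x + g i y" "1 \<le> onorm (f i) + onorm (g i)" if "i \<in> {1..n}" for i x y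
  proof -
    have D: "linear (h i)" "\<And>w. \<bar>h i w\<bar> \<le> ?q w"
      "\<And>c. \<lbrakk>c \<ge> 0; \<And>w. \<bar>h i w\<bar> \<le> c * ?q w\<rbrakk> \<Longrightarrow> 1 \<le> c"
      using dual_sphereD[OF is_norm_sum_norm[OF absolute_normalized_linf_norm]] A that by blast+
    have "linear (f i)" "linear (g i)"
      using linear_add[OF D(1), of "(_, 0)" "(_, 0)"] linear_scale[OF D(1), of _ "(_, 0)"]
        linear_add[OF D(1), of "(0, _)" "(0, _)"] linear_scale[OF D(1), of _ "(0, _)"]
      by (auto simp: f_def g_def intro!: linearI)
    moreover have "\<bar>f i x\<bar> \<le> 1 * norm x" "\<bar>g i y\<bar> \<le> 1 * norm y" for x y
      using D(2)[of "(x, 0)"] D(2)[of "(0, y)"] by (simp_all add: f_def g_def sum_norm_linf)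
    ultimately have "bounded_functional norm (f i)" "bounded_functional norm (g i)"
      unfolding bounded_functional_def by blast+
    then show f: "bounded_linear (f i)" and g: "bounded_linear (g i)"
      by (simp_all add: bounded_functional_norm)
    show split: "h i (x, y) = f i x + g i y" for x y
      using linear_add[OF D(1), of "(x, 0)" "(0, y)"] by (simp add: f_def g_def)
    have "\<bar>h i (x, y)\<bar> \<le> (onorm (f i) + onorm (g i)) * ?q (x, y)" for x y
    proof -
      have "\<bar>f i x\<bar> \<le> onorm (f i) * ?q (x, y)" "\<bar>g i y\<bar> \<le> onorm (g i) * ?q (x, y)"
        using onorm[OF f, of x] onorm[OF g, of y]
          mult_left_mono[OF _ onorm_pos_le[OF f], of "norm x" "?q (x, y)"]
          mult_left_mono[OF _ onorm_pos_le[OF g], of "norm y" "?q (x, y)"]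
        by (simp_all add: sum_norm_linf)
      then show ?thesis by (simp add: split distrib_right)
    qed
    then show "1 \<le> onorm (f i) + onorm (g i)"
      using onorm_pos_le[OF f] onorm_pos_le[OF g] by (intro D(3)) auto
  qed
  have pos: "\<alpha> i / 2 > 0" if "i \<in> {1..n}" for i using A that by simp
  obtain x u where u: "norm u \<le> 1" "norm u > 1 - \<epsilon>"
    and x: "\<forall>i\<in>{1..n}. \<forall>w\<in>{x i, x i + u, x i - u}.
       norm w \<le> 1 \<and> f i w > onorm (f i) - \<alpha> i / 2"
    by (rule SSD2P_arbitrary_functionals[where f = f and \<alpha> = "\<lambda>i. \<alpha> i / 2"
          and n = n, OF SSD nontriv fg(1) pos A(3)]) (blast intro: that)+
  have "\<forall>i\<in>{1..n}. \<exists>y. norm y \<le> 1 \<and> g i y > onorm (g i) - \<alpha> i / 2"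
    using onorm_almost_attained[OF fg(2) pos] by blast
  then obtain y where y: "\<forall>i\<in>{1..n}. norm (y i) \<le> 1 \<and> g i (y i) > onorm (g i) - \<alpha> i / 2"
    by (metis bchoice)
  have slice: "(w, y i) \<in> slice ?q (h i) (\<alpha> i)"
    if "i \<in> {1..n}" "w \<in> {x i, x i + u, x i - u}" for i w
    using bspec[OF bspec[OF x that(1)] that(2)] y that(1) fg(3,4)[OF that(1)]
    by (fastforce simp: slice_def unit_ball_def sum_norm_linf)
  show "\<exists>x y. ?q y \<le> 1 \<and> ?q y > 1 - \<epsilon> \<and>
      (\<forall>i\<in>{1..n}. {x i, x i + y, x i - y} \<subseteq> slice ?q (h i) (\<alpha> i))"
    by (rule exI[of _ "\<lambda>i. (x i, y i)"], rule exI[of _ "(u, 0)"])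
      (use u slice in \<open>auto simp: sum_norm_linf\<close>)
qed

text \<open>
  The two families of slices that witness the failures in \<open>X\<close> and \<open>Y\<close> have to be met
  simultaneously, since it is not known in advance which coordinate of the common vector is large.
  They are concatenated, the indices of the second family being shifted by \<open>n\<close>.
\<close>

lemma SSD2P_linf_sum_imp:
  assumes SSD: "SSD2P (sum_norm linf_norm :: 'a::real_normed_vector \<times> 'b::real_normed_vector \<Rightarrow> real)"
  shows "SSD2P (norm :: 'a \<Rightarrow> real) \<or> SSD2P (norm :: 'b \<Rightarrow> real)"
proof (rule ccontr)
  let ?q = "sum_norm linf_norm :: 'a \<times> 'b \<Rightarrow> real"
  assume "\<not> (SSD2P (norm :: 'a \<Rightarrow> real) \<or> SSD2P (norm :: 'b \<Rightarrow> real))"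
  then have nA: "\<not> SSD2P (norm :: 'a \<Rightarrow> real)" and nB: "\<not> SSD2P (norm :: 'b \<Rightarrow> real)" by auto
  obtain n and f :: "nat \<Rightarrow> 'a \<Rightarrow> real" and \<alpha> \<epsilon> where f: "n \<ge> 1" "\<forall>i\<in>{1..n}. f i \<in> dual_sphere norm \<and> \<alpha> i > 0" "\<epsilon> > 0"
    and nf: "\<nexists>x y. norm y \<le> 1 \<and> norm y > 1 - \<epsilon> \<and>
      (\<forall>i\<in>{1..n}. {x i, x i + y, x i - y} \<subseteq> slice norm (f i) (\<alpha> i))"
    by (rule not_SSD2P_obtain[OF nA]) (rule that)
  obtain m and g :: "nat \<Rightarrow> 'b \<Rightarrow> real" and \<beta> \<delta> where g: "m \<ge> 1" "\<forall>i\<in>{1..m}. g i \<in> dual_sphere norm \<and> \<beta> i > 0" "\<delta> > 0"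
    and ng: "\<nexists>x y. norm y \<le> 1 \<and> norm y > 1 - \<delta> \<and>
      (\<forall>i\<in>{1..m}. {x i, x i + y, x i - y} \<subseteq> slice norm (g i) (\<beta> i))"
    by (rule not_SSD2P_obtain[OF nB]) (rule that)
  define h where "h i = (if i \<le> n then f i \<circ> fst else g (i - n) \<circ> snd)" for i
  define \<gamma> where "\<gamma> i = (if i \<le> n then \<alpha> i else \<beta> (i - n))" for i
  have h: "h i \<in> dual_sphere ?q \<and> \<gamma> i > 0" if "i \<in> {1..n + m}" for i
  proof (cases "i \<le> n")
    case True
    then have "i \<in> {1..n}" using that by simp
    with f(2) True show ?thesis
      by (auto simp: h_def \<gamma>_def intro!: dual_sphere_fst[OF absolute_normalized_linf_norm])
  next
    case False
    then have "i - n \<in> {1..m}" using that by auto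
    with bspec[OF g(2)] False show ?thesis
      by (auto simp: h_def \<gamma>_def intro!: dual_sphere_snd[OF absolute_normalized_linf_norm])
  qed
  have nm: "n + m \<ge> 1" "min \<epsilon> \<delta> > 0" using f g by auto
  obtain x y where y: "?q y \<le> 1" "?q y > 1 - min \<epsilon> \<delta>"
    and x: "\<forall>i\<in>{1..n + m}. {x i, x i + y, x i - y} \<subseteq> slice ?q (h i) (\<gamma> i)"
    by (rule SSD2P_obtain[where f = h and \<alpha> = \<gamma>, OF SSD nm(1) _ nm(2)])
      (use h in \<open>blast intro: that\<close>)+
  obtain u v where uv: "y = (u, v)" by fastforce
  have slice_fst: "fst w \<in> slice norm (f i) (\<alpha> i)" if "i \<in> {1..n}" "w \<in> slice ?q (h i) (\<gamma> i)" for w i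
    using that by (cases w) (auto simp: slice_def unit_ball_def sum_norm_linf h_def \<gamma>_def)
  have slice_snd: "snd w \<in> slice norm (g i) (\<beta> i)"
    if "i \<in> {1..m}" "w \<in> slice ?q (h (n + i)) (\<gamma> (n + i))" for w i
    using that by (cases w) (auto simp: slice_def unit_ball_def sum_norm_linf h_def \<gamma>_def)
  show False
  proof (cases "norm v \<le> norm u")
    case True
    have "{fst (x i), fst (x i) + u, fst (x i) - u} \<subseteq> slice norm (f i) (\<alpha> i)" if "i \<in> {1..n}" for i
    proof -
      have "{x i, x i + y, x i - y} \<subseteq> slice ?q (h i) (\<gamma> i)" by (rule x[rule_format]) (use that in simp)
      then show ?thesis
        using slice_fst[OF that, of "x i"] slice_fst[OF that, of "x i + y"]
          slice_fst[OF that, of "x i - y"] by (simp add: uv)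
    qed
    moreover have "norm u \<le> 1" "norm u > 1 - \<epsilon>"
      using y True by (auto simp: uv sum_norm_linf)
    ultimately show False
      by (intro nf[THEN notE, where R = False] exI[of _ "\<lambda>i. fst (x i)"] exI[of _ u] conjI ballI)
  next
    case False
    have "{snd (x (n + i)), snd (x (n + i)) + v, snd (x (n + i)) - v} \<subseteq> slice norm (g i) (\<beta> i)"
      if "i \<in> {1..m}" for i
    proof -
      have "{x (n + i), x (n + i) + y, x (n + i) - y} \<subseteq> slice ?q (h (n + i)) (\<gamma> (n + i))"
        by (rule x[rule_format]) (use that in simp)
      then show ?thesis
        using slice_snd[OF that, of "x (n + i)"] slice_snd[OF that, of "x (n + i) + y"]
          slice_snd[OF that, of "x (n + i) - y"] by (simp add: uv)
    qed
    moreover have "norm v \<le> 1" "norm v > 1 - \<delta>"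
      using y False by (auto simp: uv sum_norm_linf)
    ultimately show False
      by (intro ng[THEN notE, where R = False] exI[of _ "\<lambda>i. snd (x (n + i))"] exI[of _ v] conjI ballI)
  qed
qed

lemma SSD2P_linf_sum_iff:
  assumes "\<exists>x::'a::real_normed_vector. x \<noteq> 0" and "\<exists>y::'b::real_normed_vector. y \<noteq> 0"
  shows "SSD2P (sum_norm linf_norm :: 'a \<times> 'b \<Rightarrow> real) \<longleftrightarrow>
     SSD2P (norm :: 'a \<Rightarrow> real) \<or> SSD2P (norm :: 'b \<Rightarrow> real)"
proof (intro iffI SSD2P_linf_sum_imp)
  assume "SSD2P (norm :: 'a \<Rightarrow> real) \<or> SSD2P (norm :: 'b \<Rightarrow> real)"
  then show "SSD2P (sum_norm linf_norm :: 'a \<times> 'b \<Rightarrow> real)"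
  proof
    assume "SSD2P (norm :: 'b \<Rightarrow> real)"
    then have "SSD2P (sum_norm linf_norm :: 'b \<times> 'a \<Rightarrow> real)"
      using assms SSD2P_linf_sum_of_left by blast
    then show ?thesis
      by (rule SSD2P_isometric[where T = prod.swap and S = prod.swap, rotated -1])
        (auto simp: is_norm_sum_norm absolute_normalized_linf_norm sum_norm_linf max.commute
          intro!: linearI)
  qed (use assms SSD2P_linf_sum_of_left in blast)
qed

section \<open>Absolute norms other than the maximum norm\<close>

text \<open>
  By monotonicity, \<open>N\<close> exceeds the maximum norm somewhere only if it does so on the diagonal. So
  \<open>N (1, 1) > 1\<close> is the only way in which \<open>N\<close> can differ from the maximum norm.
\<close>

lemma absolute_norm_eq_linf:
  assumes N: "absolute_normalized_norm N" and le: "N (1, 1) \<le> 1"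
  shows "N = linf_norm"
proof
  fix z :: "real \<times> real"
  obtain a b where z: "z = (a, b)" by fastforce
  define c where "c = max \<bar>a\<bar> \<bar>b\<bar>"
  have "N (a, b) \<le> N (c, c)"
    unfolding absolute_norm_abs[OF N, of a b, symmetric]
    by (rule absolute_norm_mono[OF N]) (auto simp: c_def)
  also have "\<dots> = c * N (1, 1)" using absolute_norm_scale[OF N, of c "(1, 1)"] by (simp add: c_def)
  also have "\<dots> \<le> c" using le by (simp add: c_def mult_left_le)
  finally have "N z = c"
    using absolute_norm_ge[OF N, where a = a and b = b] by (simp add: z c_def)
  then show "N z = linf_norm z" by (simp add: z linf_norm_def c_def)
qed

lemma absolute_norm_half_sum_le:
  assumes N: "absolute_normalized_norm N"
    and le: "N (a, b) \<le> 1" "N (a', b') \<le> 1"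
  shows "N ((a + a') / 2, (b + b') / 2) \<le> 1"
proof -
  have "N ((1 / 2) *\<^sub>R ((a, b) + (a', b'))) \<le> 1"
    unfolding absolute_norm_scale[OF N]
    using absolute_norm_triangle[OF N, of "(a, b)" "(a', b')"] le by simp
  then show ?thesis by (simp add: add_divide_distrib)
qed

lemma norm_le_half_sum: "norm v \<le> (norm (y + v) + norm (y - v)) / 2"
  for v y :: "'a::real_normed_vector"
  using norm_triangle_ineq4[of "y + v" "y - v"] by (simp flip: scaleR_2)

text \<open>
  The quantitative form of the midpoint argument. All constants depend on the excess
  \<open>\<kappa> = N (1, 1) - 1\<close>, which lies in \<open>(0, 1]\<close>. The slices have width \<open>\<alpha> = \<kappa> / 4\<close>. For
  \<open>s = \<parallel>u\<parallel>\<close> and \<open>t = \<parallel>v\<parallel>\<close> the inequalities \<open>N (1 - \<alpha>, t) \<le> 1\<close> and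
  \<open>N (s, 1 - \<alpha>) \<le> 1\<close> yield \<open>s, t \<le> 1 - 3 * \<alpha>\<close>, and the midpoint of the two points dominates
  \<open>(1 + \<alpha>) *\<^sub>R (s, t)\<close>. Hence \<open>N (s, t) \<le> 1 / (1 + \<alpha>)\<close>.
\<close>

lemma not_SSD2P_absolute_sum:
  fixes x\<^sub>0 :: "'a::real_normed_vector" and y\<^sub>0 :: "'b::real_normed_vector"
  assumes nontriv: "x\<^sub>0 \<noteq> 0" "y\<^sub>0 \<noteq> 0"
    and N: "absolute_normalized_norm N" and ne: "N \<noteq> linf_norm"
  shows "\<not> SSD2P (sum_norm N :: 'a \<times> 'b \<Rightarrow> real)"
proof
  let ?q = "sum_norm N :: 'a \<times> 'b \<Rightarrow> real"
  assume SSD: "SSD2P ?q"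
  note scale = absolute_norm_scale[OF N] and tri = absolute_norm_triangle[OF N]
  define \<kappa> where "\<kappa> = N (1, 1) - 1"
  have "\<kappa> > 0" using absolute_norm_eq_linf[OF N] ne by (force simp: \<kappa>_def)
  have "\<kappa> \<le> 1" using tri[of "(1, 0)" "(0, 1)"] N by (simp add: \<kappa>_def absolute_normalized_norm_def)
  define \<alpha> where "\<alpha> = \<kappa> / 4"
  obtain f :: "'a \<Rightarrow> real" and g :: "'b \<Rightarrow> real"
    where f: "f \<in> dual_sphere norm" and g: "g \<in> dual_sphere norm"
    using dual_sphere_nonempty nontriv by metis
  define h where "h i = (if i = (1::nat) then f \<circ> fst else g \<circ> snd)" for i
  have h: "h i \<in> dual_sphere ?q \<and> \<alpha> > 0" for i
    using \<open>\<kappa> > 0\<close> dual_sphere_fst[OF N f] dual_sphere_snd[OF N g] by (auto simp: h_def \<alpha>_def)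
  have pos: "(1::nat) \<le> 2" "1 - 1 / (1 + \<kappa> / 4) > 0" using \<open>\<kappa> > 0\<close> by (auto simp: field_simps)
  obtain z w where w: "?q w \<le> 1" "?q w > 1 - (1 - 1 / (1 + \<kappa> / 4))"
    and z: "\<forall>i\<in>{1..2}. {z i, z i + w, z i - w} \<subseteq> slice ?q (h i) \<alpha>"
    by (rule SSD2P_obtain[where f = h and \<alpha> = "\<lambda>_. \<alpha>", OF SSD pos(1) _ pos(2)])
      (use h in \<open>blast intro: that\<close>)+
  obtain u v where uv: "w = (u, v)" by fastforce
  obtain x y where xy: "z 1 = (x, y)" by fastforce
  obtain x' y' where xy': "z 2 = (x', y')" by fastforce
  define s t where "s = norm u" and "t = norm v"
  note Df = dual_sphereD(2)[OF is_norm_norm f] and Dg = dual_sphereD(2)[OF is_norm_norm g]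
  have N_left: "N (1 - \<alpha>, t) \<le> 1"
  proof -
    have "{(x + u, y + v), (x - u, y - v)} \<subseteq> slice ?q (f \<circ> fst) \<alpha>"
      using bspec[OF z, of 1] by (simp add: h_def xy uv del: One_nat_def)
    then have N2: "N (norm (x + u), norm (y + v)) \<le> 1" "N (norm (x - u), norm (y - v)) \<le> 1"
      and ge: "norm (x + u) \<ge> 1 - \<alpha>" "norm (x - u) \<ge> 1 - \<alpha>"
      using Df[of "x + u"] Df[of "x - u"] by (auto simp: slice_def unit_ball_def sum_norm_def)
    have "N (1 - \<alpha>, t) \<le> N ((norm (x + u) + norm (x - u)) / 2, (norm (y + v) + norm (y - v)) / 2)"
      by (rule absolute_norm_mono[OF N])
        (use ge norm_le_half_sum[of v y] \<open>\<kappa> \<le> 1\<close> in \<open>auto simp: t_def \<alpha>_def\<close>)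
    also have "\<dots> \<le> 1" by (rule absolute_norm_half_sum_le[OF N N2])
    finally show ?thesis .
  qed
  have N_right: "N (s, 1 - \<alpha>) \<le> 1"
  proof -
    have "{(x' + u, y' + v), (x' - u, y' - v)} \<subseteq> slice ?q (g \<circ> snd) \<alpha>"
      using bspec[OF z, of 2] by (simp add: h_def xy' uv)
    then have N2: "N (norm (x' + u), norm (y' + v)) \<le> 1" "N (norm (x' - u), norm (y' - v)) \<le> 1"
      and ge: "norm (y' + v) \<ge> 1 - \<alpha>" "norm (y' - v) \<ge> 1 - \<alpha>"
      using Dg[of "y' + v"] Dg[of "y' - v"] by (auto simp: slice_def unit_ball_def sum_norm_def)
    have "N (s, 1 - \<alpha>) \<le> N ((norm (x' + u) + norm (x' - u)) / 2, (norm (y' + v) + norm (y' - v)) / 2)"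
      by (rule absolute_norm_mono[OF N])
        (use ge norm_le_half_sum[of u x'] \<open>\<kappa> \<le> 1\<close> in \<open>auto simp: s_def \<alpha>_def\<close>)
    also have "\<dots> \<le> 1" by (rule absolute_norm_half_sum_le[OF N N2])
    finally show ?thesis .
  qed
  have st: "0 \<le> s" "s \<le> 1" "0 \<le> t" "t \<le> 1" "N (s, t) > 1 / (1 + \<kappa> / 4)"
    using w norm_component_le_sum_norm[OF N, of w] by (auto simp: s_def t_def uv sum_norm_def)
  \<comment> \<open>Passing from \<open>(1 - \<alpha>, t)\<close> to \<open>(1, 1)\<close> costs at most \<open>\<alpha> + (1 - t)\<close> but must gain
      \<open>\<kappa> = 4 * \<alpha>\<close>.\<close>
  have "N (1, 1) \<le> N (1 - \<alpha>, t) + N (\<alpha>, 1 - t)" "N (1, 1) \<le> N (s, 1 - \<alpha>) + N (1 - s, \<alpha>)"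
    using tri[of "(1 - \<alpha>, t)" "(\<alpha>, 1 - t)"] tri[of "(s, 1 - \<alpha>)" "(1 - s, \<alpha>)"] by simp_all
  moreover have "N (\<alpha>, 1 - t) \<le> \<alpha> + (1 - t)" "N (1 - s, \<alpha>) \<le> \<alpha> + (1 - s)"
    using tri[of "(\<alpha>, 0)" "(0, 1 - t)"] tri[of "(1 - s, 0)" "(0, \<alpha>)"] st \<open>\<kappa> > 0\<close>
    by (simp_all add: absolute_norm_axis[OF N] \<alpha>_def)
  ultimately have gap: "s \<le> 1 - 3 * \<alpha>" "t \<le> 1 - 3 * \<alpha>"
    using N_left N_right by (simp_all add: \<kappa>_def \<alpha>_def field_simps)
  have "(1 + \<kappa> / 4) * N (s, t) = N ((1 + \<alpha>) * s, (1 + \<alpha>) * t)"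
    using scale[of "1 + \<alpha>" "(s, t)"] \<open>\<kappa> > 0\<close> by (simp add: \<alpha>_def)
  also have "\<dots> \<le> N ((s + (1 - \<alpha>)) / 2, (t + (1 - \<alpha>)) / 2)"
  proof (rule absolute_norm_mono[OF N])
    have "\<alpha> * s \<le> \<alpha>" "\<alpha> * t \<le> \<alpha>"
      using st \<open>\<kappa> > 0\<close> by (auto simp: \<alpha>_def mult_left_le)
    then show "(1 + \<alpha>) * s \<le> (s + (1 - \<alpha>)) / 2" "(1 + \<alpha>) * t \<le> (t + (1 - \<alpha>)) / 2"
      using gap by (simp_all add: field_simps)
  qed (use st \<open>\<kappa> > 0\<close> in \<open>auto simp: \<alpha>_def\<close>)
  also have "\<dots> \<le> 1"
    using absolute_norm_half_sum_le[OF N N_right N_left] by (simp add: add.commute)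
  finally show False
    using st(5) \<open>\<kappa> > 0\<close> by (simp add: field_simps)
qed

theorem theorem3p1:
  assumes "\<exists>x::'a::banach. x \<noteq> 0"
    and "\<exists>y::'b::banach. y \<noteq> 0"
  shows "(SSD2P (sum_norm linf_norm :: 'a \<times> 'b \<Rightarrow> real) \<longleftrightarrow>
            SSD2P (norm :: 'a \<Rightarrow> real) \<or> SSD2P (norm :: 'b \<Rightarrow> real)) \<and>
         (\<forall>N. absolute_normalized_norm N \<longrightarrow> N \<noteq> linf_norm \<longrightarrow>
            \<not> SSD2P (sum_norm N :: 'a \<times> 'b \<Rightarrow> real))"
proof (intro conjI allI impI)
  show "SSD2P (sum_norm linf_norm :: 'a \<times> 'b \<Rightarrow> real) \<longleftrightarrow>
      SSD2P (norm :: 'a \<Rightarrow> real) \<or> SSD2P (norm :: 'b \<Rightarrow> real)"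
    by (rule SSD2P_linf_sum_iff[OF assms])
  obtain x :: 'a and y :: 'b where "x \<noteq> 0" "y \<noteq> 0" using assms by blast
  then show "\<not> SSD2P (sum_norm N :: 'a \<times> 'b \<Rightarrow> real)"
    if "absolute_normalized_norm N" "N \<noteq> linf_norm" for N
    using that by (rule not_SSD2P_absolute_sum)
qed

end
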